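(* Let $\Gamma\subset\operatorname{PSL}(2,\mathbb{R})$ be a Fuchsian group with signature $(0;n_1,\ldots,n_r)$, with compact quotient Riemann surface $\hat X=\Gamma\backslash\mathbb{H}^*$ (of genus $0$). Let $\tau_1,\ldots,\tau_r$ be the inequivalent vertices (elliptic points or cusps) of the fundamental domain of $\Gamma$, of orders $n_1,\ldots,n_r$ respectively, and let $w(\tau)$ be a Hauptmodul of $\hat X$. Let $k\ge 4$ be an even integer and put $$a_i=\Big\lfloor \frac{k}{2}\Big(1-\frac{1}{n_i}\Big)\Big\rfloor\quad (i=1,\ldots,r),\qquad d=1-k+\sum_{i=1}^r a_i .$$ Let $w_i=w(\tau_i)\in\mathbb{C}\cup\{\infty\}$ for $i=1,\ldots,r$, and for each integer $j$ with $0\le j\le d-1$ define $$h_j(\tau)=\frac{\big(w'(\tau)\big)^{k/2}\,\big(w(\tau)\big)^j}{\displaystyle\prod_{1\le i\le r,\; w_i\neq\infty}\big(w(\tau)-w_i\big)^{a_i}},\qquad \tau\in\mathbb{H}.$$ Then, for every $j=0,\ldots,d-1$, the function $h_j$ is an automorphic form of weight $k$ with respect to $\Gamma$.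
   Context: $\mathbb{H}=\{\tau\in\mathbb{C}:\operatorname{Im}\tau>0\}$, and $\operatorname{PSL}(2,\mathbb{R})=\operatorname{SL}(2,\mathbb{R})/\{\pm I_2\}$ acts on $\mathbb{H}$ and on $\mathbb{R}\cup\{\infty\}$ by $\gamma\cdot\tau=\frac{a\tau+b}{c\tau+d}$ for $\gamma=\begin{pmatrix}a&b\\c&d\end{pmatrix}$ (in matrix entries, $d$ denotes an entry and not the integer $d$ of the claim). A Fuchsian group is a discrete subgroup of $\operatorname{PSL}(2,\mathbb{R})$. An element $\gamma$ is elliptic if $|\operatorname{tr}\gamma|<2$ and parabolic if $|\operatorname{tr}\gamma|=2$ (and $\gamma$ is not the identity). An elliptic point of $\Gamma$ is a point of $\mathbb{H}$ fixed by an elliptic element of $\Gamma$; a cusp of $\Gamma$ is a point of $\mathbb{R}\cup\{\infty\}$ fixed by a parabolic element of $\Gamma$. $\mathbb{H}^*$ is the union of $\mathbb{H}$ and the set of cusps of $\Gamma$, and $\hat X=\Gamma\backslash\mathbb{H}^*$ is the quotient Riemann surface, assumed compact. $\Gamma$ has signature $(g;n_1,\ldots,n_r)$ if $\hat X$ has genus $g$ and $\tau_1,\ldots,\tau_r$ is a complete list of representatives of the $\Gamma$-inequivalent elliptic points and cusps, with orders $n_1,\ldots,n_r$. The order of an elliptic point is the order of its (finite cyclic) stabilizer in $\Gamma\subset\operatorname{PSL}(2,\mathbb{R})$; the order of a cusp is $\infty$, with the convention $1/\infty=0$. A Hauptmodul of $\hat X$ (when $\hat X$ has genus $0$) is a $\Gamma$-invariant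 meromorphic function $w$ on $\mathbb{H}$, extending to the cusps, which induces an isomorphism of Riemann surfaces $\hat X\to\mathbb{C}\cup\{\infty\}$. The value $w(\tau_i)$ at a cusp $\tau_i$ is the value of this extension. An automorphic form of weight $k$ with respect to $\Gamma$ is a holomorphic function $f:\mathbb{H}\to\mathbb{C}$ such that $f\big(\frac{a\tau+b}{c\tau+d}\big)=(c\tau+d)^k f(\tau)$ for all $\begin{pmatrix}a&b\\c&d\end{pmatrix}\in\Gamma$ and all $\tau\in\mathbb{H}$ (no condition at the cusps is part of this definition; since $k$ is even the condition does not depend on the choice of sign of the matrix). A priori $h_j$ is a meromorphic function on $\mathbb{H}$; it is regarded as a function on $\mathbb{H}$ after filling in removable singularities. *)

theory Defs
  imports "HOL-Complex_Analysis.Complex_Analysis" "HOL-Homology.Homology"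
begin

section \<open>The groups SL(2,R) and PSL(2,R)\<close>

definition SL2R :: "(real^2^2) monoid" where
  "SL2R = \<lparr>carrier = {A. det A = 1}, mult = (**), one = mat 1\<rparr>"

definition PSL2R :: "(real^2^2) set monoid" where
  "PSL2R = SL2R Mod {mat 1, - mat 1}"

definition psl_class :: "real^2^2 \<Rightarrow> (real^2^2) set" where
  "psl_class A = {mat 1, - mat 1} #>\<^bsub>SL2R\<^esub> A"

lemma psl_class_eq: "psl_class A = {A, - A}"
proof -
  have "- mat 1 ** A = - A"
    by (simp add: vec_eq_iff matrix_matrix_mult_def mat_def sum_2 forall_2)
  then show ?thesis
    by (simp add: psl_class_def r_coset_def SL2R_def insert_commute)
qed

lemma group_SL2R: "group SL2R"
proof (rule groupI)
  fix A assume A: "A \<in> carrier SL2R"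
  then have "det A \<noteq> 0" by (simp add: SL2R_def)
  then obtain B where B: "B ** A = mat 1" "A ** B = mat 1"
    using invertible_det_nz invertible_def by metis
  have "det B * det A = 1"
    using B by (metis det_I det_mul)
  with A B show "\<exists>B\<in>carrier SL2R. B \<otimes>\<^bsub>SL2R\<^esub> A = \<one>\<^bsub>SL2R\<^esub>"
    by (auto simp: SL2R_def)
qed (auto simp: SL2R_def det_mul matrix_mul_assoc)

lemma carrier_PSL2R: "carrier PSL2R = psl_class ` carrier SL2R"
  by (simp add: PSL2R_def carrier_FactGroup psl_class_def[abs_def])

lemma det_uminus2: "det (- A) = det (A :: real^2^2)"
  by (simp add: det_2)

lemma uminus_matrix_mult: "(- A) ** B = - (A ** (B :: real^2^2))" "A ** (- B) = - (A ** B)"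
  by (simp_all add: vec_eq_iff matrix_matrix_mult_def sum_2)

lemma normal_center_SL2R: "{mat 1, - mat 1} \<lhd> SL2R"
proof -
  interpret group SL2R by (rule group_SL2R)
  have "subgroup {mat 1, - mat 1} SL2R"
  proof (rule subgroupI)
    fix a assume "a \<in> {mat 1, - mat 1 :: real^2^2}"
    then have a: "a = mat 1 \<or> a = - mat 1" by simp
    then have "a \<in> carrier SL2R" "a \<otimes>\<^bsub>SL2R\<^esub> a = \<one>\<^bsub>SL2R\<^esub>"
      by (auto simp: SL2R_def det_uminus2 uminus_matrix_mult)
    then have "inv\<^bsub>SL2R\<^esub> a = a" by (simp add: inv_equality)
    with a show "inv\<^bsub>SL2R\<^esub> a \<in> {mat 1, - mat 1}" by simp
  qed (auto simp: SL2R_def det_uminus2 uminus_matrix_mult)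
  then show ?thesis
    by (rule normalI) (auto simp: r_coset_def l_coset_def SL2R_def uminus_matrix_mult)
qed

lemma group_PSL2R: "group PSL2R"
  unfolding PSL2R_def by (rule normal.factorgroup_is_group[OF normal_center_SL2R])


section \<open>Fuchsian groups\<close>

definition quotient_topology :: "'a topology \<Rightarrow> ('a \<Rightarrow> 'b) \<Rightarrow> 'b topology" where
  "quotient_topology X f =
     topology (\<lambda>U. U \<subseteq> f ` topspace X \<and> openin X {x \<in> topspace X. f x \<in> U})"

lemma openin_quotient_topology:
  "openin (quotient_topology X f) U \<longleftrightarrow>
     U \<subseteq> f ` topspace X \<and> openin X {x \<in> topspace X. f x \<in> U}"
proof -
  have "istopology (\<lambda>U. U \<subseteq> f ` topspace X \<and> openin X {x \<in> topspace X. f x \<in> U})"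
    unfolding istopology_def
  proof (intro conjI allI impI; (elim conjE)?)
    fix S T
    assume "openin X {x \<in> topspace X. f x \<in> S}" "openin X {x \<in> topspace X. f x \<in> T}"
    then have "openin X ({x \<in> topspace X. f x \<in> S} \<inter> {x \<in> topspace X. f x \<in> T})"
      by blast
    then show "openin X {x \<in> topspace X. f x \<in> S \<inter> T}"
      by (rule back_subst) auto
  next
    fix \<K> assume *: "\<forall>K\<in>\<K>. K \<subseteq> f ` topspace X \<and> openin X {x \<in> topspace X. f x \<in> K}"
    have "openin X (\<Union>K\<in>\<K>. {x \<in> topspace X. f x \<in> K})"
      using * by blast
    then show "openin X {x \<in> topspace X. f x \<in> \<Union>\<K>}"
      by (rule back_subst) auto
  qed auto
  then show ?thesis
    by (simp add: quotient_topology_def)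
qed

lemma topspace_quotient_topology: "topspace (quotient_topology X f) = f ` topspace X"
proof -
  have "{x \<in> topspace X. f x \<in> f ` topspace X} = topspace X" by auto
  then have "openin (quotient_topology X f) (f ` topspace X)"
    by (simp add: openin_quotient_topology)
  then show ?thesis
    by (metis openin_quotient_topology openin_subset openin_topspace subset_antisym)
qed

lemma quotient_map_quotient_topology: "quotient_map X (quotient_topology X f) f"
  by (auto simp: quotient_map_def topspace_quotient_topology openin_quotient_topology)

definition PSL2R_topology :: "(real^2^2) set topology" where
  "PSL2R_topology = quotient_topology (top_of_set (carrier SL2R)) psl_class"

definition fuchsian :: "(real^2^2) set set \<Rightarrow> bool" where
  "fuchsian \<Gamma> \<longleftrightarrow>
     subgroup \<Gamma> PSL2R \<and> subtopology PSL2R_topology \<Gamma> = discrete_topology \<Gamma>"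


section \<open>Action on the Riemann sphere\<close>

text \<open>
  Points of the Riemann sphere are values of type \<^typ>\<open>complex option\<close>, with \<^term>\<open>None\<close> as the
  point at infinity. The upper half plane, the real line and infinity are all regarded as
  parts of it.
\<close>

abbreviation upper_half_plane :: "complex set" (\<open>\<H>\<close>) where
  "\<H> \<equiv> {z. Im z > 0}"

definition mat_moebius :: "real^2^2 \<Rightarrow> complex \<Rightarrow> complex" where
  "mat_moebius A = moebius (of_real (A$1$1)) (of_real (A$1$2)) (of_real (A$2$1)) (of_real (A$2$2))"

definition aut_factor :: "real^2^2 \<Rightarrow> complex \<Rightarrow> complex" where
  "aut_factor A z = of_real (A$2$1) * z + of_real (A$2$2)"

fun mat_act :: "real^2^2 \<Rightarrow> complex option \<Rightarrow> complex option" where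
  "mat_act A None = (if A$2$1 = 0 then None else Some (of_real (A$1$1) / of_real (A$2$1)))"
| "mat_act A (Some z) = (if aut_factor A z = 0 then None else Some (mat_moebius A z))"

definition psl_act :: "(real^2^2) set \<Rightarrow> complex option \<Rightarrow> complex option" where
  "psl_act \<gamma> p = the_elem ((\<lambda>A. mat_act A p) ` \<gamma>)"

lemma mat_act_uminus: "mat_act (- A) p = mat_act A p"
proof (cases p)
  case (Some z)
  have "aut_factor (- A) z = - aut_factor A z"
    by (simp add: aut_factor_def)
  moreover have "mat_moebius (- A) z = mat_moebius A z"
  proof -
    have "mat_moebius (- A) z = (- (A$1$1 * z + A$1$2)) / (- (A$2$1 * z + A$2$2))"
      by (simp add: mat_moebius_def moebius_def)
    then show ?thesis
      by (simp only: minus_divide_divide) (simp add: mat_moebius_def moebius_def)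
  qed
  ultimately show ?thesis using Some by simp
qed simp

lemma psl_act_psl_class: "psl_act (psl_class A) p = mat_act A p"
  by (simp add: psl_act_def psl_class_eq mat_act_uminus)

definition orbit :: "(real^2^2) set set \<Rightarrow> complex option \<Rightarrow> complex option set" where
  "orbit \<Gamma> p = (\<lambda>\<gamma>. psl_act \<gamma> p) ` \<Gamma>"

definition stabilizer :: "(real^2^2) set set \<Rightarrow> complex option \<Rightarrow> (real^2^2) set set" where
  "stabilizer \<Gamma> p = {\<gamma> \<in> \<Gamma>. psl_act \<gamma> p = p}"


section \<open>Elliptic points, cusps and the extended upper half plane\<close>

definition elliptic :: "(real^2^2) set \<Rightarrow> bool" where
  "elliptic \<gamma> \<longleftrightarrow> (\<forall>A\<in>\<gamma>. \<bar>trace A\<bar> < 2)"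

definition parabolic :: "(real^2^2) set \<Rightarrow> bool" where
  "parabolic \<gamma> \<longleftrightarrow> \<gamma> \<noteq> \<one>\<^bsub>PSL2R\<^esub> \<and> (\<forall>A\<in>\<gamma>. \<bar>trace A\<bar> = 2)"

definition elliptic_points :: "(real^2^2) set set \<Rightarrow> complex option set" where
  "elliptic_points \<Gamma> = {p \<in> Some ` \<H>. \<exists>\<gamma>\<in>\<Gamma>. elliptic \<gamma> \<and> psl_act \<gamma> p = p}"

definition cusps :: "(real^2^2) set set \<Rightarrow> complex option set" where
  "cusps \<Gamma> = {p \<in> insert None (Some ` of_real ` (UNIV :: real set)).
                 \<exists>\<gamma>\<in>\<Gamma>. parabolic \<gamma> \<and> psl_act \<gamma> p = p}"

text \<open>The order of an elliptic point is that of its stabilizer in PSL(2,R), not in SL(2,R).\<close>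

definition vertex_order :: "(real^2^2) set set \<Rightarrow> complex option \<Rightarrow> enat" where
  "vertex_order \<Gamma> p = (if p \<in> cusps \<Gamma> then \<infinity> else enat (card (stabilizer \<Gamma> p)))"

definition recip_order :: "enat \<Rightarrow> real" where
  "recip_order n = (case n of enat m \<Rightarrow> 1 / real m | \<infinity> \<Rightarrow> 0)"

definition Hstar :: "(real^2^2) set set \<Rightarrow> complex option set" where
  "Hstar \<Gamma> = Some ` \<H> \<union> cusps \<Gamma>"

text \<open>
  The usual horoball topology: a neighbourhood of a cusp \<open>\<sigma> \<infinity>\<close> is a set that contains the cusp
  and the image under \<open>\<sigma>\<close> of a half plane \<open>Im z > y\<close>. The choice of \<open>\<sigma>\<close> is irrelevant, since
  two choices differ by an affine map of the half plane.
\<close>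

definition Hstar_open :: "(real^2^2) set set \<Rightarrow> complex option set \<Rightarrow> bool" where
  "Hstar_open \<Gamma> U \<longleftrightarrow> U \<subseteq> Hstar \<Gamma> \<and> open {z \<in> \<H>. Some z \<in> U} \<and>
     (\<forall>\<sigma>\<in>carrier SL2R. mat_act \<sigma> None \<in> U \<inter> cusps \<Gamma> \<longrightarrow>
        (\<exists>y>0. \<forall>z. Im z > y \<longrightarrow> mat_act \<sigma> (Some z) \<in> U))"

definition Hstar_topology :: "(real^2^2) set set \<Rightarrow> complex option topology" where
  "Hstar_topology \<Gamma> = topology (Hstar_open \<Gamma>)"

lemma openin_Hstar_topology: "openin (Hstar_topology \<Gamma>) = Hstar_open \<Gamma>"
proof -
  have "istopology (Hstar_open \<Gamma>)"
    unfolding istopology_def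
  proof (intro conjI allI impI)
    fix S T assume S: "Hstar_open \<Gamma> S" and T: "Hstar_open \<Gamma> T"
    have "{z \<in> \<H>. Some z \<in> S \<inter> T} = {z \<in> \<H>. Some z \<in> S} \<inter> {z \<in> \<H>. Some z \<in> T}"
      by auto
    then have 1: "open {z \<in> \<H>. Some z \<in> S \<inter> T}"
      using S T by (simp add: Hstar_open_def open_Int)
    have 2: "\<exists>y>0. \<forall>z. Im z > y \<longrightarrow> mat_act \<sigma> (Some z) \<in> S \<inter> T"
      if "\<sigma> \<in> carrier SL2R" "mat_act \<sigma> None \<in> S \<inter> T \<inter> cusps \<Gamma>" for \<sigma>
    proof -
      have "\<exists>y>0. \<forall>z. Im z > y \<longrightarrow> mat_act \<sigma> (Some z) \<in> S"
        using S that by (simp only: Hstar_open_def Int_iff)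
      then obtain y1 where y1: "y1 > 0" "\<forall>z. Im z > y1 \<longrightarrow> mat_act \<sigma> (Some z) \<in> S"
        by blast
      have "\<exists>y>0. \<forall>z. Im z > y \<longrightarrow> mat_act \<sigma> (Some z) \<in> T"
        using T that by (simp only: Hstar_open_def Int_iff)
      then obtain y2 where y2: "y2 > 0" "\<forall>z. Im z > y2 \<longrightarrow> mat_act \<sigma> (Some z) \<in> T"
        by blast
      from y1 y2 show ?thesis
        by (intro exI[of _ "max y1 y2"]) auto
    qed
    from S have 3: "S \<inter> T \<subseteq> Hstar \<Gamma>" by (auto simp: Hstar_open_def)
    from 1 2 3 show "Hstar_open \<Gamma> (S \<inter> T)"
      by (simp only: Hstar_open_def) blast
  next
    fix \<K> assume K: "\<forall>K\<in>\<K>. Hstar_open \<Gamma> K"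
    have "{z \<in> \<H>. Some z \<in> \<Union>\<K>} = (\<Union>K\<in>\<K>. {z \<in> \<H>. Some z \<in> K})"
      by auto
    moreover have "open \<dots>"
      using K by (intro open_UN) (simp add: Hstar_open_def)
    ultimately have 1: "open {z \<in> \<H>. Some z \<in> \<Union>\<K>}" by simp
    have 2: "\<Union>\<K> \<subseteq> Hstar \<Gamma>" using K by (auto simp: Hstar_open_def)
    have 3: "\<exists>y>0. \<forall>z. Im z > y \<longrightarrow> mat_act \<sigma> (Some z) \<in> \<Union>\<K>"
      if "\<sigma> \<in> carrier SL2R" "mat_act \<sigma> None \<in> \<Union>\<K> \<inter> cusps \<Gamma>" for \<sigma>
    proof -
      from that obtain K where "K \<in> \<K>" "mat_act \<sigma> None \<in> K \<inter> cusps \<Gamma>"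
        by blast
      then have "\<exists>y>0. \<forall>z. Im z > y \<longrightarrow> mat_act \<sigma> (Some z) \<in> K"
        using K that(1) by (simp only: Hstar_open_def)
      then show ?thesis using \<open>K \<in> \<K>\<close> by blast
    qed
    from 1 2 3 show "Hstar_open \<Gamma> (\<Union>\<K>)"
      by (simp only: Hstar_open_def) blast
  qed
  then show ?thesis
    by (simp add: Hstar_topology_def)
qed


section \<open>Riemann surfaces and holomorphic maps\<close>

text \<open>
  A surface is a topological space together with a set of charts \<open>(U, \<phi>)\<close>; the values of \<open>\<phi>\<close>
  outside the open set \<open>U\<close> are irrelevant.
\<close>

type_synonym 'a surface = "'a topology \<times> ('a set \<times> ('a \<Rightarrow> complex)) set"

definition holomorphic_map :: "'a surface \<Rightarrow> 'b surface \<Rightarrow> ('a \<Rightarrow> 'b) \<Rightarrow> bool" where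
  "holomorphic_map S T f \<longleftrightarrow> continuous_map (fst S) (fst T) f \<and>
     (\<forall>(U, \<phi>)\<in>snd S. \<forall>(V, \<psi>)\<in>snd T.
        (\<psi> \<circ> f \<circ> the_inv_into U \<phi>) holomorphic_on \<phi> ` {x \<in> U. f x \<in> V})"

definition biholomorphic_map :: "'a surface \<Rightarrow> 'b surface \<Rightarrow> ('a \<Rightarrow> 'b) \<Rightarrow> bool" where
  "biholomorphic_map S T f \<longleftrightarrow>
     (\<exists>g. homeomorphic_maps (fst S) (fst T) f g \<and> holomorphic_map S T f \<and> holomorphic_map T S g)"

definition riemann_sphere :: "complex option surface" where
  "riemann_sphere =
     (Alexandroff_compactification euclidean,
      {(range Some, the),
       (- {Some 0}, \<lambda>p. case p of None \<Rightarrow> 0 | Some z \<Rightarrow> 1 / z)})"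

text \<open>A compact Riemann surface of genus \<open>g\<close> has first integral homology group \<open>\<int>\<^bsup>2g\<^esup>\<close>.\<close>

definition has_genus :: "'a topology \<Rightarrow> nat \<Rightarrow> bool" where
  "has_genus X g \<longleftrightarrow> homology_group 1 X \<cong> free_Abelian_group {..<2 * g}"


section \<open>The quotient surface\<close>

definition Xhat_topology :: "(real^2^2) set set \<Rightarrow> complex option set topology" where
  "Xhat_topology \<Gamma> = quotient_topology (Hstar_topology \<Gamma>) (orbit \<Gamma>)"

text \<open>
  Around the orbit of a point \<open>\<tau>\<^sub>0\<close> of the upper half plane with stabilizer of order \<open>n\<close>, a local
  parameter is \<open>((z - \<tau>\<^sub>0) / (z - cnj \<tau>\<^sub>0))\<^sup>n\<close>; injectivity of \<open>\<phi>\<close> on \<open>U\<close> says that the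
  neighbourhood \<open>N\<close> is small enough for it to be a chart.
\<close>

definition interior_charts ::
    "(real^2^2) set set \<Rightarrow> (complex option set set \<times> (complex option set \<Rightarrow> complex)) set" where
  "interior_charts \<Gamma> = {(U, \<phi>). \<exists>\<tau>\<^sub>0 N. \<tau>\<^sub>0 \<in> N \<and> open N \<and> N \<subseteq> \<H> \<and>
      U = (\<lambda>z. orbit \<Gamma> (Some z)) ` N \<and> inj_on \<phi> U \<and>
      (\<forall>z\<in>N. \<phi> (orbit \<Gamma> (Some z)) =
               ((z - \<tau>\<^sub>0) / (z - cnj \<tau>\<^sub>0)) ^ card (stabilizer \<Gamma> (Some \<tau>\<^sub>0)))}"

definition translation :: "real \<Rightarrow> real^2^2" where
  "translation x = vector [vector [1, x], vector [0, 1]]"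

text \<open>
  Around a cusp \<open>\<sigma> \<infinity>\<close> the local parameter is \<open>exp (2 \<pi> \<i> z / h)\<close> at the point \<open>\<sigma> z\<close>, where
  \<open>h\<close> is the width of the cusp with respect to \<open>\<sigma>\<close>.
\<close>

definition cusp_charts ::
    "(real^2^2) set set \<Rightarrow> (complex option set set \<times> (complex option set \<Rightarrow> complex)) set" where
  "cusp_charts \<Gamma> = {(U, \<phi>). \<exists>\<sigma> h y. \<sigma> \<in> carrier SL2R \<and> mat_act \<sigma> None \<in> cusps \<Gamma> \<and>
      h > 0 \<and> y > 0 \<and>
      (\<forall>x. psl_class (\<sigma> ** translation x ** matrix_inv \<sigma>) \<in> \<Gamma> \<longleftrightarrow> (\<exists>m::int. x = of_int m * h)) \<and>
      U = (\<lambda>p. orbit \<Gamma> (mat_act \<sigma> p)) ` insert None (Some ` {z. Im z > y}) \<and> inj_on \<phi> U \<and>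
      \<phi> (orbit \<Gamma> (mat_act \<sigma> None)) = 0 \<and>
      (\<forall>z. Im z > y \<longrightarrow>
         \<phi> (orbit \<Gamma> (mat_act \<sigma> (Some z))) = exp (2 * of_real pi * \<i> * z / of_real h))}"

definition Xhat :: "(real^2^2) set set \<Rightarrow> complex option set surface" where
  "Xhat \<Gamma> = (Xhat_topology \<Gamma>, interior_charts \<Gamma> \<union> cusp_charts \<Gamma>)"

text \<open>
  \<open>\<Gamma>\<close> has signature \<open>(g; n 1, \<dots>, n r)\<close>, where \<open>\<tau> 1, \<dots>, \<tau> r\<close> are representatives of the
  inequivalent elliptic points and cusps.
\<close>

definition has_signature ::
    "(real^2^2) set set \<Rightarrow> nat \<Rightarrow> nat \<Rightarrow> (nat \<Rightarrow> complex option) \<Rightarrow> (nat \<Rightarrow> enat) \<Rightarrow> bool" where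
  "has_signature \<Gamma> g r \<tau> n \<longleftrightarrow>
     has_genus (Xhat_topology \<Gamma>) g \<and>
     (\<forall>i\<in>{1..r}. \<tau> i \<in> elliptic_points \<Gamma> \<union> cusps \<Gamma>) \<and>
     inj_on (\<lambda>i. orbit \<Gamma> (\<tau> i)) {1..r} \<and>
     (\<forall>p \<in> elliptic_points \<Gamma> \<union> cusps \<Gamma>. \<exists>i\<in>{1..r}. p \<in> orbit \<Gamma> (\<tau> i)) \<and>
     (\<forall>i\<in>{1..r}. n i = vertex_order \<Gamma> (\<tau> i))"


section \<open>Hauptmoduln and automorphic forms\<close>

text \<open>
  A meromorphic function is a function \<^typ>\<open>complex \<Rightarrow> complex\<close>, and its value at a pole is to be
  read as infinity.
\<close>

definition sphere_value :: "(complex \<Rightarrow> complex) \<Rightarrow> complex \<Rightarrow> complex option" where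
  "sphere_value w z = (if is_pole w z then None else Some (w z))"

definition cusp_limit ::
    "(real^2^2) set set \<Rightarrow> (complex \<Rightarrow> complex) \<Rightarrow> complex option \<Rightarrow> complex option \<Rightarrow> bool" where
  "cusp_limit \<Gamma> w s l \<longleftrightarrow>
     limitin (fst riemann_sphere) (\<lambda>p. sphere_value w (the p)) l
             (atin_within (Hstar_topology \<Gamma>) s (Some ` \<H>))"

definition extended_value ::
    "(real^2^2) set set \<Rightarrow> (complex \<Rightarrow> complex) \<Rightarrow> complex option \<Rightarrow> complex option" where
  "extended_value \<Gamma> w p =
     (if p \<in> cusps \<Gamma> then (THE l. cusp_limit \<Gamma> w p l) else sphere_value w (the p))"

definition hauptmodul :: "(real^2^2) set set \<Rightarrow> (complex \<Rightarrow> complex) \<Rightarrow> bool" where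
  "hauptmodul \<Gamma> w \<longleftrightarrow>
     w nicely_meromorphic_on \<H> \<and>
     (\<forall>A. psl_class A \<in> \<Gamma> \<longrightarrow> (\<forall>z\<in>\<H>. sphere_value w (mat_moebius A z) = sphere_value w z)) \<and>
     (\<forall>s\<in>cusps \<Gamma>. \<exists>l. cusp_limit \<Gamma> w s l) \<and>
     (\<exists>F. biholomorphic_map (Xhat \<Gamma>) riemann_sphere F \<and>
          (\<forall>p\<in>Hstar \<Gamma>. F (orbit \<Gamma> p) = extended_value \<Gamma> w p))"

definition automorphic_form :: "(real^2^2) set set \<Rightarrow> nat \<Rightarrow> (complex \<Rightarrow> complex) \<Rightarrow> bool" where
  "automorphic_form \<Gamma> k f \<longleftrightarrow> f holomorphic_on \<H> \<and>
     (\<forall>A. psl_class A \<in> \<Gamma> \<longrightarrow> (\<forall>z\<in>\<H>. f (mat_moebius A z) = aut_factor A z ^ k * f z))"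

end

theory Submission
  imports Defs
begin

text \<open>
  Write \<open>k = 2 K\<close> and let \<open>m\<close> be the ramification of the Hauptmodul \<open>w\<close> at a point \<open>z\<close> of the
  upper half plane: the order of \<open>w - w(z)\<close> there, or the order of the pole. The quotient \<open>h\<^sub>j\<close> is
  meromorphic, so it is to be shown that its order at \<open>z\<close> is nonnegative and that it transforms
  with weight \<open>k\<close>. The latter is the chain rule: \<open>w\<close> is invariant and a fractional linear
  transformation of determinant 1 has derivative \<open>(c z + d)\<^sup>-\<^sup>2\<close>.

  For the order, the essential inequality is \<open>N \<le> m\<close>, where \<open>N\<close> is the order of the stabilizer of
  \<open>z\<close>. An element of the stabilizer has at its fixed point \<open>z\<close> a derivative \<open>\<zeta>\<close> that determines it,
  and comparing leading coefficients in \<open>w(\<gamma> x) = w(x)\<close> gives \<open>\<zeta>\<^sup>m = 1\<close>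
  (\<^verbatim>\<open>derivative_at_fixed_point_powi_zorder\<close>); hence there are at most \<open>m\<close> of them
  (\<^verbatim>\<open>card_stabilizer_le_zorder\<close>), and the same count shows that the stabilizer is finite.

  The isomorphism with the sphere enters in two ways. It is open, so \<open>w\<close> is not constant
  (\<^verbatim>\<open>hauptmodul_nonconstant\<close>), and \<open>m\<close> is well defined and positive. It is injective, so at most one
  vertex \<open>\<tau>\<^sub>i\<close> has \<open>w\<^sub>i = w(z)\<close>, and that vertex is equivalent to \<open>z\<close>. Because of
  \<open>a\<^sub>i \<le> K (1 - 1/N) \<le> K (1 - 1/m)\<close>, the sum \<open>S\<close> of the \<open>a\<^sub>i\<close> with \<open>w\<^sub>i = w(z)\<close>, which has at most
  one term, satisfies \<open>m S \<le> K (m - 1)\<close> (\<^verbatim>\<open>sum_vertex_exponents_bound\<close>).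

  If \<open>w(z)\<close> is finite, \<open>w'\<close> has order \<open>m - 1\<close>, and the order of \<open>h\<^sub>j\<close> is at least
  \<open>K (m - 1) - m S \<ge> 0\<close>. If \<open>w\<close> has a pole at \<open>z\<close>, then \<open>w'\<close> has order \<open>- m - 1\<close>, the factors
  of the denominator have poles of order \<open>m\<close>, and the order of \<open>h\<^sub>j\<close> is
  \<open>- K (m + 1) - j m + m (\<Sum>\<^sub>i a\<^sub>i - S)\<close>. The condition \<open>j \<le> d - 1\<close> says
  \<open>\<Sum>\<^sub>i a\<^sub>i - j \<ge> 2 K\<close>, which makes this at least \<open>2 K m - K (m + 1) - K (m - 1) = 0\<close>
  (\<^verbatim>\<open>zorder_derivative_quotient_nonneg\<close>).
\<close>

(* Besides vector components, a second meaning of this symbol gives terms with several matrix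
   entries A$i$j exponentially many parse trees. *)
no_notation fps_nth (infixl \<open>$\<close> 75)

section \<open>Fractional linear transformations and the orbits of the half plane\<close>

lemma aut_factor_nonzero:
  assumes "det A = 1" "z \<in> \<H>"
  shows "aut_factor A z \<noteq> 0"
proof
  assume eq: "aut_factor A z = 0"
  then have "Im (aut_factor A z) = 0" by simp
  then have c: "A$2$1 = 0" using assms(2) by (simp add: aut_factor_def)
  with eq have "A$2$2 = 0" by (simp add: aut_factor_def)
  with c assms(1) show False by (simp add: det_2)
qed

lemma mat_moebius_eq:
  "mat_moebius A z = (of_real (A$1$1) * z + of_real (A$1$2)) / aut_factor A z"
  by (simp add: mat_moebius_def moebius_def aut_factor_def)

lemma Im_mat_moebius:
  assumes "det A = 1" "z \<in> \<H>"
  shows "Im (mat_moebius A z) = Im z / (cmod (aut_factor A z))\<^sup>2"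
proof -
  have "Im ((of_real (A$1$1) * z + of_real (A$1$2)) * cnj (aut_factor A z)) = det A * Im z"
    by (simp add: aut_factor_def det_2 algebra_simps)
  then show ?thesis
    using assms by (simp add: mat_moebius_eq complex_div_cnj[of _ "aut_factor A z"])
qed

lemma mat_moebius_in_H:
  assumes "det A = 1" "z \<in> \<H>"
  shows "mat_moebius A z \<in> \<H>"
  using assms aut_factor_nonzero[OF assms] by (simp add: Im_mat_moebius)

lemma has_field_derivative_mat_moebius:
  assumes "det A = 1" "z \<in> \<H>"
  shows "(mat_moebius A has_field_derivative 1 / (aut_factor A z)\<^sup>2) (at z)"
proof -
  have det: "complex_of_real (A$1$1) * of_real (A$2$2) - of_real (A$1$2) * of_real (A$2$1) = 1"
    using assms(1) by (simp add: det_2 flip: of_real_mult of_real_diff)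
  have "mat_moebius A = (\<lambda>z. (of_real (A$1$1) * z + of_real (A$1$2)) / aut_factor A z)"
    by (simp add: mat_moebius_eq fun_eq_iff)
  moreover have "((\<lambda>z. (of_real (A$1$1) * z + of_real (A$1$2)) / aut_factor A z)
      has_field_derivative (of_real (A$1$1) * aut_factor A z
        - (of_real (A$1$1) * z + of_real (A$1$2)) * of_real (A$2$1)) / (aut_factor A z)\<^sup>2) (at z)"
    unfolding power2_eq_square
    by (rule DERIV_divide)
       (use aut_factor_nonzero[OF assms] in \<open>auto simp: aut_factor_def intro!: derivative_eq_intros\<close>)
  moreover have "of_real (A$1$1) * aut_factor A z
      - (of_real (A$1$1) * z + of_real (A$1$2)) * of_real (A$2$1) = 1"
    using det by (simp add: aut_factor_def algebra_simps)
  ultimately show ?thesis by simp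
qed

lemma mat_act_H:
  assumes "det A = 1" "z \<in> \<H>"
  shows "mat_act A (Some z) = Some (mat_moebius A z)"
  using aut_factor_nonzero[OF assms] by simp

text \<open>
  The condition on \<open>A\<close> in the definitions of a Hauptmodul and of an automorphic form is only that its
  class lies in \<open>\<Gamma>\<close>; this restricts \<open>A\<close> to determinant 1, since \<open>A\<close> and \<open>- A\<close> have the same determinant.
\<close>

lemma psl_class_in_subgroupD:
  assumes "subgroup \<Gamma> PSL2R" "psl_class A \<in> \<Gamma>"
  shows "det A = 1"
proof -
  have "psl_class A \<in> psl_class ` carrier SL2R"
    using subgroup.mem_carrier[OF assms] by (simp add: carrier_PSL2R)
  then obtain B where B: "det B = 1" "{A, - A} = {B, - B}"
    by (auto simp: psl_class_eq SL2R_def)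
  then have "A = B \<or> A = - B" by (metis insertCI insertE singletonD)
  with B show ?thesis by (auto simp: det_uminus2)
qed

lemma subgroup_PSL2R_cases:
  assumes "subgroup \<Gamma> PSL2R" "\<gamma> \<in> \<Gamma>"
  obtains A where "\<gamma> = psl_class A" "det A = 1"
proof -
  have "\<gamma> \<in> psl_class ` carrier SL2R"
    using subgroup.mem_carrier[OF assms] by (simp add: carrier_PSL2R)
  then show ?thesis using that by (auto simp: SL2R_def)
qed

lemma one_PSL2R: "\<one>\<^bsub>PSL2R\<^esub> = psl_class (mat 1)"
  by (simp add: PSL2R_def psl_class_eq FactGroup_def)

lemma mat_moebius_one: "mat_moebius (mat 1) z = z"
  by (simp add: mat_moebius_def moebius_def mat_def)

lemma psl_class_one_in_subgroup:
  assumes "subgroup \<Gamma> PSL2R"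
  shows "psl_class (mat 1) \<in> \<Gamma>"
  using subgroup.one_closed[OF assms] by (simp add: one_PSL2R)

lemma mem_orbit:
  assumes "subgroup \<Gamma> PSL2R"
  shows "p \<in> orbit \<Gamma> p"
proof -
  have "psl_act (psl_class (mat 1)) p = p"
    by (cases p) (auto simp: psl_act_psl_class mat_moebius_one, auto simp: aut_factor_def mat_def)
  then show ?thesis
    using psl_class_one_in_subgroup[OF assms] unfolding orbit_def by (metis image_eqI)
qed

lemma orbit_H_cases:
  assumes "subgroup \<Gamma> PSL2R" "z \<in> \<H>" "q \<in> orbit \<Gamma> (Some z)"
  obtains A where "psl_class A \<in> \<Gamma>" "det A = 1" "q = Some (mat_moebius A z)"
proof -
  from assms(3) obtain \<gamma> where \<gamma>: "\<gamma> \<in> \<Gamma>" "q = psl_act \<gamma> (Some z)"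
    by (auto simp: orbit_def)
  obtain A where A: "\<gamma> = psl_class A" "det A = 1"
    using subgroup_PSL2R_cases[OF assms(1) \<gamma>(1)] .
  show ?thesis
    using that[of A] \<gamma> A mat_act_H[OF A(2) assms(2)] by (simp add: psl_act_psl_class)
qed

lemma eventually_at_H: "z \<in> \<H> \<Longrightarrow> eventually (\<lambda>x. x \<in> \<H>) (at z)"
  by (rule eventually_at_in_open') (auto simp: open_halfspace_Im_gt)


section \<open>The stabilizer of a point and the order of an invariant function\<close>

text \<open>
  Near \<open>z\<close> write \<open>f(x) = g(x) (x - z)\<^sup>n\<close> with \<open>g(z) \<noteq> 0\<close>. Dividing \<open>f(\<phi>(x)) = f(x)\<close> by \<open>(x - z)\<^sup>n\<close>
  gives \<open>g(\<phi>(x)) ((\<phi>(x) - z) / (x - z))\<^sup>n = g(x)\<close>, and \<open>x \<rightarrow> z\<close> yields \<open>g(z) \<zeta>\<^sup>n = g(z)\<close>.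
\<close>

lemma derivative_at_fixed_point_powi_zorder:
  fixes f \<phi> :: "complex \<Rightarrow> complex"
  assumes "f meromorphic_on {z}" "eventually (\<lambda>x. f x \<noteq> 0) (at z)"
    and "\<phi> z = z" "(\<phi> has_field_derivative \<zeta>) (at z)" "\<zeta> \<noteq> 0"
    and inv: "eventually (\<lambda>x. f (\<phi> x) = f x) (at z)"
  shows "\<zeta> powi zorder f z = 1"
proof -
  define n where "n = zorder f z"
  define g where "g = zor_poly f z"
  have "isolated_singularity_at f z" "not_essential f z"
    using assms(1) by (auto simp: meromorphic_at_iff)
  moreover have "frequently (\<lambda>x. f x \<noteq> 0) (at z)"
    using assms(2) by (simp add: eventually_frequently)
  ultimately obtain r where gz: "g z \<noteq> 0" and r: "r > 0" "g holomorphic_on cball z r"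
      and f: "\<And>x. x \<in> cball z r - {z} \<Longrightarrow> f x = g x * (x - z) powi n"
    using zorder_exist[of f z] unfolding n_def g_def by blast
  have g: "g \<midarrow>z\<rightarrow> g z"
  proof -
    have "g holomorphic_on ball z r"
      using r(2) by (rule holomorphic_on_subset) auto
    then have "isCont g z"
      using r(1) by (meson centre_in_ball continuous_on_eq_continuous_at
          holomorphic_on_imp_continuous_on open_ball)
    then show ?thesis by (simp add: isCont_def)
  qed
  define q where "q = (\<lambda>x. (\<phi> x - z) / (x - z))"
  have q: "q \<midarrow>z\<rightarrow> \<zeta>"
    using assms(3,4) by (simp add: has_field_derivative_iff q_def)
  have "isCont \<phi> z" using assms(4) by (rule DERIV_isCont)
  then have \<phi>: "\<phi> \<midarrow>z\<rightarrow> z" using assms(3) by (simp add: isCont_def)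
  have "eventually (\<lambda>x. q x \<noteq> 0) (at z)"
    using q \<open>\<zeta> \<noteq> 0\<close> by (rule tendsto_imp_eventually_ne)
  then have ne: "eventually (\<lambda>x. \<phi> x \<noteq> z) (at z)"
    by eventually_elim (auto simp: q_def)
  have g\<phi>: "((\<lambda>x. g (\<phi> x)) \<longlongrightarrow> g z) (at z)"
    by (rule filterlim_compose[OF g]) (use \<phi> ne in \<open>simp add: filterlim_at\<close>)
  have ball: "eventually (\<lambda>x. x \<in> cball z r - {z}) (at z)"
    using eventually_at_in_open[of "ball z r" z] r(1)
    by (auto elim!: eventually_mono)
  have "eventually (\<lambda>x. \<phi> x \<in> ball z r) (at z)"
    using \<phi> r(1) by (intro topological_tendstoD[of \<phi> z]) auto
  with ball ne inv have "eventually (\<lambda>x. g (\<phi> x) * q x powi n = g x) (at z)"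
  proof eventually_elim
    case (elim x)
    then have "g (\<phi> x) * (\<phi> x - z) powi n = g x * (x - z) powi n"
      using f[of x] f[of "\<phi> x"] by auto
    moreover have "(x - z) powi n \<noteq> 0" using elim by (simp add: power_int_not_zero)
    ultimately show ?case
      by (simp add: q_def power_int_divide_distrib divide_simps)
  qed
  moreover have "((\<lambda>x. g (\<phi> x) * q x powi n) \<longlongrightarrow> g z * \<zeta> powi n) (at z)"
    using g\<phi> q \<open>\<zeta> \<noteq> 0\<close> by (intro tendsto_intros) auto
  ultimately have "(g \<longlongrightarrow> g z * \<zeta> powi n) (at z)"
    using Lim_transform_eventually by fastforce
  then have "g z * \<zeta> powi n = g z"
    using g by (intro tendsto_unique[of "at z"]) auto
  then show ?thesis using gz by (simp add: n_def)
qed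

text \<open>
  An element of PSL(2,R) that fixes \<open>z\<close> is determined by its derivative \<open>(c z + d)\<^sup>-\<^sup>2\<close> there: this
  number gives \<open>c z + d\<close> up to sign, the fixed point equation then gives \<open>a z + b\<close>, and real
  coefficients can be read off from both because \<open>z\<close> is not real.
\<close>

lemma fixing_matrix_determined:
  assumes "det A = 1" "det B = 1" "z \<in> \<H>"
    and "mat_moebius A z = z" "mat_moebius B z = z"
    and "(aut_factor A z)\<^sup>2 = (aut_factor B z)\<^sup>2"
  shows "psl_class A = psl_class B"
proof -
  have eq: "C = B" if C: "det C = 1" "mat_moebius C z = z" "aut_factor C z = aut_factor B z" for C
  proof -
    have num: "of_real (M$1$1) * z + of_real (M$1$2) = z * aut_factor M z"
      if "det M = 1" "mat_moebius M z = z" for M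
      using that aut_factor_nonzero[of M z] assms(3) by (simp add: mat_moebius_eq divide_simps)
    have real: "s = s' \<and> t = t'"
      if "complex_of_real s * z + of_real t = of_real s' * z + of_real t'" for s t s' t'
    proof -
      have "Im (of_real s * z + of_real t) = Im (of_real s' * z + of_real t')"
        using that by simp
      then have "s = s'" using assms(3) by simp
      with that show ?thesis by simp
    qed
    have "of_real (C$1$1) * z + of_real (C$1$2) = of_real (B$1$1) * z + of_real (B$1$2)"
      using num[OF C(1,2)] num[OF assms(2,5)] C(3) by simp
    then have "C$1$1 = B$1$1 \<and> C$1$2 = B$1$2" by (rule real)
    moreover have "C$2$1 = B$2$1 \<and> C$2$2 = B$2$2"
      using C(3) unfolding aut_factor_def by (rule real)
    ultimately show ?thesis by (simp add: vec_eq_iff forall_2)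
  qed
  have "aut_factor A z = aut_factor B z \<or> aut_factor A z = - aut_factor B z"
    using assms(6) by (simp add: power2_eq_iff)
  then show ?thesis
  proof
    assume "aut_factor A z = aut_factor B z"
    then show ?thesis using eq[of A] assms by simp
  next
    assume *: "aut_factor A z = - aut_factor B z"
    have af: "aut_factor (- A) z = - aut_factor A z"
      by (simp add: aut_factor_def)
    have dA: "det (- A) = 1" using assms(1) by (simp add: det_uminus2)
    have "Some (mat_moebius (- A) z) = Some (mat_moebius A z)"
      using mat_act_uminus[of A "Some z"] mat_act_H[OF dA assms(3)] mat_act_H[OF assms(1,3)]
      by metis
    then have "- A = B"
      using eq[of "- A"] assms * dA af by simp
    then show ?thesis by (auto simp: psl_class_eq)
  qed
qed

text \<open>
  Sending an element of the stabilizer to \<open>(c z + d)\<^sup>2\<close> embeds the stabilizer into the roots of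
  unity of exponent \<open>\<bar>zorder f z\<bar>\<close>. The absolute value lets \<open>f\<close> have a zero or a pole at \<open>z\<close>.
  Positivity of the cardinality expresses finiteness of the stabilizer.
\<close>

lemma card_stabilizer_le_zorder:
  assumes \<Gamma>: "subgroup \<Gamma> PSL2R" and z: "z \<in> \<H>"
    and f: "f meromorphic_on {z}" "eventually (\<lambda>x. f x \<noteq> 0) (at z)" "zorder f z \<noteq> 0"
    and inv: "\<And>A. psl_class A \<in> \<Gamma> \<Longrightarrow> mat_moebius A z = z \<Longrightarrow>
                eventually (\<lambda>x. f (mat_moebius A x) = f x) (at z)"
  shows "0 < card (stabilizer \<Gamma> (Some z))"
    and "card (stabilizer \<Gamma> (Some z)) \<le> nat \<bar>zorder f z\<bar>"
proof -
  define S where "S = stabilizer \<Gamma> (Some z)"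
  define m where "m = nat \<bar>zorder f z\<bar>"
  have m: "m \<ge> 1" using f(3) by (simp add: m_def)
  \<comment> \<open>well defined on classes, since the square does not see the sign of the matrix\<close>
  define J where "J = (\<lambda>\<gamma>. the_elem ((\<lambda>A. (aut_factor A z)\<^sup>2) ` \<gamma>))"
  have J: "J (psl_class A) = (aut_factor A z)\<^sup>2" for A
  proof -
    have "aut_factor (- A) z = - aut_factor A z"
      by (simp add: aut_factor_def)
    then show ?thesis by (simp add: J_def psl_class_eq)
  qed
  have cases: "\<exists>A. \<gamma> = psl_class A \<and> psl_class A \<in> \<Gamma> \<and> det A = 1 \<and> mat_moebius A z = z"
    if "\<gamma> \<in> S" for \<gamma>
  proof -
    from that have \<gamma>: "\<gamma> \<in> \<Gamma>" "psl_act \<gamma> (Some z) = Some z"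
      by (auto simp: S_def stabilizer_def)
    obtain A where A: "\<gamma> = psl_class A" "det A = 1"
      using subgroup_PSL2R_cases[OF \<Gamma> \<gamma>(1)] .
    then show ?thesis
      using \<gamma> mat_act_H[OF A(2) z] by (auto simp: psl_act_psl_class)
  qed
  have "inj_on J S"
  proof (rule inj_onI)
    fix \<gamma> \<delta> assume "\<gamma> \<in> S" "\<delta> \<in> S" "J \<gamma> = J \<delta>"
    then show "\<gamma> = \<delta>"
      using cases[of \<gamma>] cases[of \<delta>] fixing_matrix_determined[OF _ _ z] J by metis
  qed
  moreover have "J ` S \<subseteq> {u. u ^ m = 1}"
  proof safe
    fix \<gamma> assume "\<gamma> \<in> S"
    then obtain A where A: "\<gamma> = psl_class A" "psl_class A \<in> \<Gamma>" "det A = 1" "mat_moebius A z = z"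
      using cases by blast
    have "(1 / (aut_factor A z)\<^sup>2) powi zorder f z = 1"
      using has_field_derivative_mat_moebius[OF A(3) z] aut_factor_nonzero[OF A(3) z] inv[OF A(2,4)]
      by (intro derivative_at_fixed_point_powi_zorder[where \<phi> = "mat_moebius A"] f A(4)) auto
    then have "J \<gamma> powi zorder f z = 1"
      by (simp add: A(1) J power_int_divide_distrib)
    then show "J \<gamma> ^ m = 1"
      by (cases "zorder f z \<ge> 0") (auto simp: m_def power_int_def power_inverse)
  qed
  moreover have fin: "finite {u::complex. u ^ m = 1}"
    using m by (rule finite_roots_unity)
  ultimately have "finite S" "card S \<le> card {u::complex. u ^ m = 1}"
    by (auto intro: inj_on_finite card_inj_on_le)
  then show "card (stabilizer \<Gamma> (Some z)) \<le> nat \<bar>zorder f z\<bar>"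
    using card_roots_unity[OF m, where 'a=complex] by (simp add: S_def m_def)
  have "psl_class (mat 1) \<in> S"
    using psl_class_one_in_subgroup[OF \<Gamma>] mat_act_H[of "mat 1" z] z
    by (auto simp: S_def stabilizer_def psl_act_psl_class mat_moebius_one)
  then show "0 < card (stabilizer \<Gamma> (Some z))"
    using \<open>finite S\<close> by (auto simp: S_def card_gt_0_iff)
qed


section \<open>A Hauptmodul separates orbits and is not constant\<close>

lemma topspace_Hstar_topology: "topspace (Hstar_topology \<Gamma>) = Hstar \<Gamma>"
proof -
  have "Hstar_open \<Gamma> (Hstar \<Gamma>)"
    unfolding Hstar_open_def
  proof (intro conjI ballI impI)
    have "{z \<in> \<H>. Some z \<in> Hstar \<Gamma>} = \<H>" by (auto simp: Hstar_def)
    then show "open {z \<in> \<H>. Some z \<in> Hstar \<Gamma>}" by (simp add: open_halfspace_Im_gt)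
    fix \<sigma> assume "\<sigma> \<in> carrier SL2R"
    then have "det \<sigma> = 1" by (simp add: SL2R_def)
    then show "\<exists>y>0. \<forall>z. Im z > y \<longrightarrow> mat_act \<sigma> (Some z) \<in> Hstar \<Gamma>"
      using mat_act_H[of \<sigma>] mat_moebius_in_H[of \<sigma>]
      by (intro exI[of _ 1]) (auto simp: Hstar_def simp del: mat_act.simps)
  qed auto
  moreover have "S \<subseteq> Hstar \<Gamma>" if "Hstar_open \<Gamma> S" for S
    using that by (simp add: Hstar_open_def)
  ultimately show ?thesis
    unfolding topspace_def openin_Hstar_topology by blast
qed

lemma extended_value_H:
  "z \<in> \<H> \<Longrightarrow> extended_value \<Gamma> w (Some z) = sphere_value w z"
  by (auto simp: extended_value_def cusps_def)

lemma hauptmodul_separates_orbits: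
  assumes "hauptmodul \<Gamma> w" "p \<in> Hstar \<Gamma>" "q \<in> Hstar \<Gamma>"
    and "extended_value \<Gamma> w p = extended_value \<Gamma> w q"
  shows "orbit \<Gamma> p = orbit \<Gamma> q"
proof -
  obtain F G where FG: "homeomorphic_maps (fst (Xhat \<Gamma>)) (fst riemann_sphere) F G"
      "\<forall>p\<in>Hstar \<Gamma>. F (orbit \<Gamma> p) = extended_value \<Gamma> w p"
    using assms(1) unfolding hauptmodul_def biholomorphic_map_def by blast
  have "topspace (fst (Xhat \<Gamma>)) = orbit \<Gamma> ` Hstar \<Gamma>"
    by (simp add: Xhat_def Xhat_topology_def topspace_quotient_topology topspace_Hstar_topology)
  then have "orbit \<Gamma> p \<in> topspace (fst (Xhat \<Gamma>))" "orbit \<Gamma> q \<in> topspace (fst (Xhat \<Gamma>))"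
    using assms(2,3) by auto
  then show ?thesis
    using FG assms(2-4) unfolding homeomorphic_maps_def by metis
qed

lemma not_openin_riemann_sphere_singleton: "\<not> openin (fst riemann_sphere) {c}"
proof
  assume "openin (fst riemann_sphere) {c}"
  then have *: "openin (Alexandroff_compactification (euclidean :: complex topology)) {c}"
    by (simp add: riemann_sphere_def)
  show False
  proof (cases c)
    case None
    with * obtain C where "{None} = insert None (Some ` (UNIV - C))" "compact (C :: complex set)"
      by (auto simp: openin_Alexandroff_compactification)
    then have "C = UNIV" "compact C" by auto
    then show False using not_compact_UNIV by blast
  next
    case (Some x)
    with * obtain U where "open U" "{Some x} = Some ` U"
      by (auto simp: openin_Alexandroff_compactification)
    then have "open {x}" by (metis image_empty image_insert inj_Some inj_image_eq_iff)
    then show False by (simp add: not_open_singleton)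
  qed
qed

text \<open>
  A Hauptmodul that takes a value \<open>c\<close> at points accumulating at \<open>z\<close> is equal to \<open>c\<close> on the whole half plane. Orbits
  are separated by their values, so the half plane is then a single orbit. This orbit is an open
  point of the quotient surface, because the half plane is open in \<open>\<H>\<^sup>*\<close>; but the sphere, which is
  homeomorphic to the surface, has no open points.
\<close>

lemma hauptmodul_nonconstant:
  assumes \<Gamma>: "subgroup \<Gamma> PSL2R" and w: "hauptmodul \<Gamma> w" and z: "z \<in> \<H>"
  shows "eventually (\<lambda>x. w x \<noteq> c) (at z)"
proof (rule ccontr)
  assume "\<not> ?thesis"
  then have "frequently (\<lambda>x. w x = c) (at z)" by (simp add: frequently_def)
  moreover have "w nicely_meromorphic_on \<H>" using w by (simp add: hauptmodul_def)
  moreover have "connected \<H>" by (intro convex_connected convex_halfspace_Im_gt)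
  ultimately have const: "w x = c" if "x \<in> \<H>" for x
    using frequently_eq_meromorphic_imp_constant[of w c z \<H> x] z that
    by (simp add: open_halfspace_Im_gt)
  have sv: "sphere_value w x = Some c" if x: "x \<in> \<H>" for x
  proof -
    have "eventually (\<lambda>y. w y = c) (at x)"
      using eventually_at_H[OF x] by eventually_elim (rule const)
    then have "w \<midarrow>x\<rightarrow> c" by (rule tendsto_eventually)
    then have "\<not> is_pole w x"
      using not_tendsto_and_filterlim_at_infinity[of "at x" w c] by (auto simp: is_pole_def)
    then show ?thesis using const[OF x] by (simp add: sphere_value_def)
  qed
  define o0 where "o0 = orbit \<Gamma> (Some z)"
  have H: "Some x \<in> Hstar \<Gamma>" if "x \<in> \<H>" for x using that by (auto simp: Hstar_def)
  have orb: "orbit \<Gamma> (Some x) = o0" if "x \<in> \<H>" for x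
    unfolding o0_def
    by (rule hauptmodul_separates_orbits[OF w]) (use H that z extended_value_H sv in auto)
  have pre: "{p \<in> Hstar \<Gamma>. orbit \<Gamma> p \<in> {o0}} = Some ` \<H>"
  proof (intro subset_antisym subsetI)
    fix p assume "p \<in> {p \<in> Hstar \<Gamma>. orbit \<Gamma> p \<in> {o0}}"
    then have "p \<in> orbit \<Gamma> (Some z)"
      using mem_orbit[OF \<Gamma>, of p] by (simp add: o0_def)
    then show "p \<in> Some ` \<H>"
      using orbit_H_cases[OF \<Gamma> z] mat_moebius_in_H z by blast
  qed (use H orb in auto)
  have "Hstar_open \<Gamma> (Some ` \<H>)"
  proof -
    have "{x \<in> \<H>. Some x \<in> Some ` \<H>} = \<H>" by auto
    moreover have "Some ` \<H> \<inter> cusps \<Gamma> = {}" by (auto simp: cusps_def)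
    ultimately show ?thesis
      by (simp add: Hstar_open_def open_halfspace_Im_gt) (auto simp: Hstar_def)
  qed
  then have "openin (Xhat_topology \<Gamma>) {o0}"
    using pre z H[OF z]
    by (simp add: Xhat_topology_def openin_quotient_topology topspace_Hstar_topology
        openin_Hstar_topology o0_def)
  moreover obtain F G where "homeomorphic_maps (fst (Xhat \<Gamma>)) (fst riemann_sphere) F G"
    using w unfolding hauptmodul_def biholomorphic_map_def by blast
  then have "open_map (fst (Xhat \<Gamma>)) (fst riemann_sphere) F"
    by (meson homeomorphic_imp_open_map homeomorphic_maps_map)
  ultimately have "openin (fst riemann_sphere) (F ` {o0})"
    unfolding open_map_def Xhat_def fst_conv by blast
  then show False using not_openin_riemann_sphere_singleton by simp
qed


section \<open>Ramification\<close>

text \<open>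
  The multiplicity with which \<open>w\<close>, as a map to the sphere, takes its value at \<open>z\<close>.
\<close>

definition ramification :: "(complex \<Rightarrow> complex) \<Rightarrow> complex \<Rightarrow> nat" where
  "ramification w z = nat \<bar>zorder (if is_pole w z then w else (\<lambda>x. w x - w z)) z\<bar>"

text \<open>
  This equality holds also where \<open>w\<close> is not differentiable, because both sides are then the same
  unspecified value. So it can be used at poles.
\<close>

lemma deriv_diff_const: "deriv (\<lambda>x. w x - c) = deriv (w :: complex \<Rightarrow> complex)"
proof
  fix x
  have "((\<lambda>x. w x - c) has_field_derivative D) (at x) \<longleftrightarrow> (w has_field_derivative D) (at x)" for D
    using DERIV_add[of "\<lambda>x. w x - c" D x UNIV "\<lambda>_. c" 0] DERIV_diff[of w D x UNIV "\<lambda>_. c" 0]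
    by auto
  then show "deriv (\<lambda>x. w x - c) x = deriv w x"
    by (simp add: deriv_def)
qed

locale nonconstant_at =
  fixes w :: "complex \<Rightarrow> complex" and z :: complex
  assumes nicely: "w nicely_meromorphic_on {z}"
    and nonconstant: "eventually (\<lambda>x. w x \<noteq> c) (at z)"
begin

lemma meromorphic: "w meromorphic_on {z}"
  using nicely by (simp add: nicely_meromorphic_on_def)

lemma frequently_neq: "frequently (\<lambda>x. w x \<noteq> c) (at z)"
  using nonconstant by (simp add: eventually_frequently)

lemma meromorphic_diff: "(\<lambda>x. w x - c) meromorphic_on {z}"
  by (intro meromorphic_intros meromorphic)

lemma eventually_diff_nonzero: "eventually (\<lambda>x. w x - c \<noteq> 0) (at z)"
  using nonconstant[of c] by simp

lemma analytic: "\<not> is_pole w z \<Longrightarrow> w analytic_on {z}"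
  using nicely_meromorphic_on_imp_analytic_at[OF nicely, of z] by simp

lemma zorder_pole:
  assumes "is_pole w z"
  shows "zorder w z = - int (ramification w z)" and "ramification w z > 0"
  using isolated_pole_imp_neg_zorder[OF _ assms] meromorphic assms
  by (auto simp: ramification_def meromorphic_at_iff)

lemma zorder_regular:
  assumes "\<not> is_pole w z"
  shows "zorder (\<lambda>x. w x - w z) z = int (ramification w z)" and "ramification w z > 0"
proof -
  have "(\<lambda>x. w x - w z) analytic_on {z}"
    by (intro analytic_intros analytic assms)
  then have "zorder (\<lambda>x. w x - w z) z > 0"
    using frequently_neq[of "w z"] by (subst zorder_pos_iff') auto
  then show "zorder (\<lambda>x. w x - w z) z = int (ramification w z)" "ramification w z > 0"
    using assms by (auto simp: ramification_def)
qed

lemma ramification_pos: "ramification w z > 0"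
  using zorder_pole(2) zorder_regular(2) by blast

lemma zorder_diff_const:
  "zorder (\<lambda>x. w x - c) z =
     (if is_pole w z then - int (ramification w z)
      else if c = w z then int (ramification w z) else 0)"
proof (cases "is_pole w z")
  case True
  have "zorder (\<lambda>x. w x - c) z = zorder w z"
  proof (cases "c = 0")
    case False
    then show ?thesis
      using meromorphic frequently_neq[of 0] zorder_pole[OF True]
      by (intro zorder_diff1) auto
  qed simp
  then show ?thesis using True zorder_pole by simp
next
  case False
  have "zorder (\<lambda>x. w x - c) z = 0" if "c \<noteq> w z"
    using that analytic[OF False] by (intro zorder_eq_0I) (auto intro!: analytic_intros)
  then show ?thesis using False zorder_regular by auto
qed

lemma deriv_facts:
  shows deriv_meromorphic: "deriv w meromorphic_on {z}"
    and eventually_deriv_nonzero: "eventually (\<lambda>x. deriv w x \<noteq> 0) (at z)"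
    and zorder_deriv: "zorder (deriv w) z =
      (if is_pole w z then - int (ramification w z) - 1 else int (ramification w z) - 1)"
proof -
  show "deriv w meromorphic_on {z}"
    by (intro meromorphic_intros meromorphic)
  define f where "f = (\<lambda>x. w x - w z)"
  have f: "f meromorphic_on {z}" "eventually (\<lambda>x. f x \<noteq> 0) (at z)"
    unfolding f_def by (rule meromorphic_diff eventually_diff_nonzero)+
  have ord: "zorder f z = (if is_pole w z then - int (ramification w z) else int (ramification w z))"
    using zorder_diff_const[of "w z"] by (simp add: f_def)
  then have nz: "zorder f z \<noteq> 0" using ramification_pos by auto
  have deriv: "deriv f = deriv w" unfolding f_def by (rule deriv_diff_const)
  have "zorder (deriv f) z = zorder f z - 1"
    using f nz by (intro zorder_deriv_minus_1) (auto simp: meromorphic_at_iff eventually_frequently)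
  then show "zorder (deriv w) z =
      (if is_pole w z then - int (ramification w z) - 1 else int (ramification w z) - 1)"
    using ord deriv by auto
  obtain L where L: "(\<lambda>x. f (z + x)) has_laurent_expansion L"
    using f(1) by (auto simp: meromorphic_on_def)
  moreover have "L \<noteq> 0"
    using f(2) has_laurent_expansion_eventually_nonzero_iff[OF L] by simp
  ultimately have "fls_subdegree L \<noteq> 0"
    using nz has_laurent_expansion_zorder by metis
  then show "eventually (\<lambda>x. deriv w x \<noteq> 0) (at z)"
    using subdegree_imp_eventually_deriv_nzero[OF L] deriv by simp
qed

end

section \<open>The order of the quotients at a point\<close>

text \<open>
  The quotient \<open>h\<^sub>j\<close>, with arbitrary values \<open>v\<^sub>i\<close> in the sphere and exponents \<open>a\<^sub>i\<close>: the computation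
  of its order at a point is local and involves no group.
\<close>

definition derivative_quotient ::
    "(complex \<Rightarrow> complex) \<Rightarrow> nat \<Rightarrow> nat \<Rightarrow> 'i set \<Rightarrow> ('i \<Rightarrow> complex option) \<Rightarrow> ('i \<Rightarrow> int) \<Rightarrow> complex \<Rightarrow> complex"
  where "derivative_quotient w K j I v a x =
    deriv w x ^ K * w x ^ j / (\<Prod>i \<in> {i \<in> I. v i \<noteq> None}. (w x - the (v i)) powi a i)"

context nonconstant_at
begin

context
  fixes I :: "'i set" and v :: "'i \<Rightarrow> complex option" and a :: "'i \<Rightarrow> int"
  assumes fin: "finite I"
begin

lemma derivative_quotient_meromorphic: "derivative_quotient w K j I v a meromorphic_on {z}"
  unfolding derivative_quotient_def by (intro meromorphic_intros meromorphic)

lemma eventually_denominator_nonzero: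
  "eventually (\<lambda>x. (\<Prod>i\<in>{i \<in> I. v i \<noteq> None}. (w x - the (v i)) powi a i) \<noteq> 0) (at z)"
proof -
  have "eventually (\<lambda>x. \<forall>i\<in>{i \<in> I. v i \<noteq> None}. w x - the (v i) \<noteq> 0) (at z)"
    using fin eventually_diff_nonzero by (intro eventually_ball_finite) auto
  then show ?thesis
    by eventually_elim (use fin in \<open>auto simp: power_int_not_zero\<close>)
qed

lemma zorder_derivative_quotient:
  "zorder (derivative_quotient w K j I v a) z =
     int K * zorder (deriv w) z + int j * zorder w z
       - (\<Sum>i\<in>{i \<in> I. v i \<noteq> None}. a i * zorder (\<lambda>x. w x - the (v i)) z)"
proof -
  let ?D = "\<lambda>x. \<Prod>i\<in>{i \<in> I. v i \<noteq> None}. (w x - the (v i)) powi a i"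
  let ?N = "\<lambda>x. deriv w x ^ K * w x ^ j"
  have N: "?N meromorphic_on {z}"
    by (intro meromorphic_intros meromorphic)
  have D: "?D meromorphic_on {z}"
    by (intro meromorphic_intros meromorphic)
  have fN1: "eventually (\<lambda>x. deriv w x ^ K \<noteq> 0) (at z)"
    using eventually_deriv_nonzero by eventually_elim simp
  have fN2: "eventually (\<lambda>x. w x ^ j \<noteq> 0) (at z)"
    using nonconstant[of 0] by eventually_elim simp
  have fN: "eventually (\<lambda>x. ?N x \<noteq> 0) (at z)"
    using fN1 fN2 by eventually_elim simp
  have "zorder (derivative_quotient w K j I v a) z = zorder ?N z - zorder ?D z"
    unfolding derivative_quotient_def
    by (rule zorder_divide[OF N _ D])
       (use fN eventually_denominator_nonzero in \<open>auto simp: eventually_frequently\<close>)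
  also have "zorder ?N z = zorder (\<lambda>x. deriv w x ^ K) z + zorder (\<lambda>x. w x ^ j) z"
    by (rule zorder_mult)
       (use fN1 fN2 in \<open>auto simp: eventually_frequently intro!: meromorphic_intros meromorphic\<close>)
  also have "zorder (\<lambda>x. deriv w x ^ K) z = int K * zorder (deriv w) z"
    using eventually_deriv_nonzero
    by (intro zorder_power deriv_meromorphic) (simp add: eventually_frequently)
  also have "zorder (\<lambda>x. w x ^ j) z = int j * zorder w z"
    by (intro zorder_power meromorphic frequently_neq)
  also have "zorder ?D z = (\<Sum>i\<in>{i \<in> I. v i \<noteq> None}. zorder (\<lambda>x. (w x - the (v i)) powi a i) z)"
    by (intro zorder_prod meromorphic_intros meromorphic eventually_denominator_nonzero)
  also have "\<dots> = (\<Sum>i\<in>{i \<in> I. v i \<noteq> None}. a i * zorder (\<lambda>x. w x - the (v i)) z)"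
    using eventually_diff_nonzero
    by (intro sum.cong refl zorder_power_int meromorphic_diff) (simp add: eventually_frequently)
  finally show ?thesis .
qed

text \<open>
  The first hypothesis is the local bound \<open>m S \<le> K (m - 1)\<close> for the exponents that belong to the
  value of \<open>w\<close> at \<open>z\<close>; the second one matters at poles only, where the exponents that belong to
  the other values must make up for the poles of \<open>w'\<close> and of \<open>w\<^sup>j\<close>.
\<close>

lemma zorder_derivative_quotient_nonneg:
  assumes local: "int (ramification w z) * (\<Sum>i | i \<in> I \<and> v i = sphere_value w z. a i)
                    \<le> int K * (int (ramification w z) - 1)"
    and global: "2 * int K + int j \<le> (\<Sum>i\<in>I. a i)"
  shows "zorder (derivative_quotient w K j I v a) z \<ge> 0"
proof (cases "is_pole w z")
  case True
  define m where "m = int (ramification w z)"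
  have m: "m > 0" using ramification_pos by (simp add: m_def)
  define S where "S = (\<Sum>i | i \<in> I \<and> v i = None. a i)"
  have S: "m * S \<le> int K * (m - 1)"
    using local True by (simp add: sphere_value_def m_def S_def)
  have "(\<Sum>i\<in>I. a i) = (\<Sum>i\<in>I \<inter> {i. v i \<noteq> None}. a i) + (\<Sum>i\<in>I \<inter> - {i. v i \<noteq> None}. a i)"
    by (rule sum.Int_Diff[OF fin, unfolded Diff_eq])
  then have split: "(\<Sum>i\<in>{i \<in> I. v i \<noteq> None}. a i) = (\<Sum>i\<in>I. a i) - S"
    by (simp add: S_def Int_def)
  have "zorder (derivative_quotient w K j I v a) z =
      int K * (- m - 1) + int j * (- m) - (\<Sum>i\<in>{i \<in> I. v i \<noteq> None}. a i * (- m))"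
    using True zorder_pole zorder_deriv zorder_diff_const
    by (simp add: zorder_derivative_quotient m_def)
  also have "\<dots> = - int K * (m + 1) - int j * m + m * ((\<Sum>i\<in>I. a i) - S)"
    by (simp add: sum_negf flip: split sum_distrib_right) (simp add: algebra_simps)
  also have "\<dots> \<ge> - int K * (m + 1) - int j * m + m * (2 * int K + int j) - int K * (m - 1)"
  proof -
    have "m * (2 * int K + int j) \<le> m * (\<Sum>i\<in>I. a i)"
      using global m by (intro mult_left_mono) auto
    with S show ?thesis by (simp add: right_diff_distrib)
  qed
  finally show ?thesis by (simp add: algebra_simps)
next
  case False
  define m where "m = int (ramification w z)"
  have w0: "zorder w z \<ge> 0"
    using analytic[OF False] frequently_neq[of 0] by (rule zorder_ge_0)
  have "(\<Sum>i\<in>{i \<in> I. v i \<noteq> None}. a i * zorder (\<lambda>x. w x - the (v i)) z)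
      = (\<Sum>i\<in>{i \<in> I. v i \<noteq> None}. if v i = sphere_value w z then m * a i else 0)"
    using False by (intro sum.cong refl) (auto simp: zorder_diff_const sphere_value_def m_def)
  also have "\<dots> = (\<Sum>i\<in>{i \<in> I. v i \<noteq> None} \<inter> {i. v i = sphere_value w z}. m * a i)"
    using fin by (intro sum.mono_neutral_cong_right) auto
  also have "{i \<in> I. v i \<noteq> None} \<inter> {i. v i = sphere_value w z} = {i. i \<in> I \<and> v i = sphere_value w z}"
    using False by (auto simp: sphere_value_def)
  finally have "zorder (derivative_quotient w K j I v a) z =
      int K * (m - 1) + int j * zorder w z - m * (\<Sum>i | i \<in> I \<and> v i = sphere_value w z. a i)"
    using False zorder_deriv
    by (simp add: zorder_derivative_quotient m_def sum_distrib_left)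
  moreover have "int j * zorder w z \<ge> 0" using w0 by simp
  ultimately show ?thesis using local unfolding m_def by linarith
qed

lemma remove_sings_derivative_quotient_analytic:
  assumes "zorder (derivative_quotient w K j I v a) z \<ge> 0"
  shows "remove_sings (derivative_quotient w K j I v a) analytic_on {z}"
proof -
  let ?q = "derivative_quotient w K j I v a"
  have iso: "isolated_singularity_at ?q z" and ess: "not_essential ?q z"
    using derivative_quotient_meromorphic by (auto simp: meromorphic_at_iff)
  have "\<not> is_pole ?q z"
    using isolated_pole_imp_neg_zorder[OF iso] assms by auto
  then obtain c where "?q \<midarrow>z\<rightarrow> c" using ess by (auto simp: not_essential_def)
  with iso show ?thesis by (rule remove_sings_analytic_at)
qed

end

end

section \<open>Invariance of a Hauptmodul\<close>

lemma filterlim_at_of_derivative_nonzero: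
  fixes \<phi> :: "complex \<Rightarrow> complex"
  assumes "(\<phi> has_field_derivative \<zeta>) (at z)" "\<zeta> \<noteq> 0"
  shows "filterlim \<phi> (at (\<phi> z)) (at z)"
proof -
  have "((\<lambda>x. (\<phi> x - \<phi> z) / (x - z)) \<longlongrightarrow> \<zeta>) (at z)"
    using assms(1) by (simp add: has_field_derivative_iff)
  then have "eventually (\<lambda>x. (\<phi> x - \<phi> z) / (x - z) \<noteq> 0) (at z)"
    using assms(2) by (rule tendsto_imp_eventually_ne)
  then have "eventually (\<lambda>x. \<phi> x \<noteq> \<phi> z) (at z)"
    by eventually_elim auto
  moreover have "\<phi> \<midarrow>z\<rightarrow> \<phi> z"
    using DERIV_isCont[OF assms(1)] by (simp add: isCont_def)
  ultimately show ?thesis by (simp add: filterlim_at)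
qed

lemma filterlim_mat_moebius:
  assumes "det A = 1" "z \<in> \<H>"
  shows "filterlim (mat_moebius A) (at (mat_moebius A z)) (at z)"
  by (rule filterlim_at_of_derivative_nonzero[OF has_field_derivative_mat_moebius[OF assms]])
     (use aut_factor_nonzero[OF assms] in simp)

lemma hauptmodul_is_pole_mat_moebius:
  assumes "hauptmodul \<Gamma> w" "psl_class A \<in> \<Gamma>" "z \<in> \<H>"
  shows "is_pole w (mat_moebius A z) \<longleftrightarrow> is_pole w z"
proof -
  have "sphere_value w (mat_moebius A z) = sphere_value w z"
    using assms unfolding hauptmodul_def by blast
  then show ?thesis by (auto simp: sphere_value_def split: if_splits)
qed

text \<open>
  The invariance in the definition is one of sphere values. It holds for \<open>w\<close> as a complex function
  also at poles, where a nicely meromorphic function has the value 0.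
\<close>

lemma hauptmodul_mat_moebius:
  assumes "subgroup \<Gamma> PSL2R" "hauptmodul \<Gamma> w" "psl_class A \<in> \<Gamma>" "z \<in> \<H>"
  shows "w (mat_moebius A z) = w z"
proof -
  have sv: "sphere_value w (mat_moebius A z) = sphere_value w z"
    using assms unfolding hauptmodul_def by blast
  have "mat_moebius A z \<in> \<H>"
    using mat_moebius_in_H psl_class_in_subgroupD assms by blast
  moreover have "w x = 0" if "x \<in> \<H>" "is_pole w x" for x
  proof -
    have "is_pole w x \<and> w x = 0 \<or> w \<midarrow>x\<rightarrow> w x"
      using assms(2) that(1) unfolding hauptmodul_def nicely_meromorphic_on_def by blast
    then show ?thesis
      using that(2) not_tendsto_and_filterlim_at_infinity[of "at x" w "w x"]
      by (auto simp: is_pole_def)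
  qed
  ultimately show ?thesis
    using sv assms(4) by (auto simp: sphere_value_def split: if_splits)
qed

lemma hauptmodul_nonconstant_at:
  assumes "subgroup \<Gamma> PSL2R" "hauptmodul \<Gamma> w" "z \<in> \<H>"
  shows "nonconstant_at w z"
proof
  show "w nicely_meromorphic_on {z}"
    using assms nicely_meromorphic_on_subset[of w \<H> "{z}"] by (auto simp: hauptmodul_def)
  show "eventually (\<lambda>x. w x \<noteq> c) (at z)" for c
    using assms by (rule hauptmodul_nonconstant)
qed

text \<open>
  A vertex \<open>\<tau>\<^sub>i\<close> is only equivalent to the point \<open>z\<close> at which the order of the quotient is computed.
  This lemma moves the bound for the stabilizer of \<open>\<tau>\<^sub>i\<close> to \<open>z\<close>.
\<close>

lemma ramification_mat_moebius:
  assumes \<Gamma>: "subgroup \<Gamma> PSL2R" and w: "hauptmodul \<Gamma> w" and A: "psl_class A \<in> \<Gamma>" and z: "z \<in> \<H>"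
  shows "ramification w (mat_moebius A z) = ramification w z"
proof -
  define t where "t = mat_moebius A z"
  have det: "det A = 1" using psl_class_in_subgroupD[OF \<Gamma> A] .
  have t: "t \<in> \<H>" using mat_moebius_in_H[OF det z] by (simp add: t_def)
  interpret t: nonconstant_at w t using hauptmodul_nonconstant_at[OF \<Gamma> w t] .
  define c where "c = (if is_pole w z then 0 else w z)"
  define f where "f = (\<lambda>x. w x - c)"
  have wt: "w t = w z" "is_pole w t \<longleftrightarrow> is_pole w z"
    using hauptmodul_mat_moebius[OF \<Gamma> w A z] hauptmodul_is_pole_mat_moebius[OF w A z]
    by (simp_all add: t_def)
  have r: "ramification w t = nat \<bar>zorder f t\<bar>" "ramification w z = nat \<bar>zorder f z\<bar>"
    by (auto simp: ramification_def f_def c_def wt)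
  have "open \<H>" by (simp add: open_halfspace_Im_gt)
  have hol: "mat_moebius A holomorphic_on \<H>"
    using has_field_derivative_mat_moebius[OF det] \<open>open \<H>\<close> by (auto simp: holomorphic_on_open)
  then have an: "mat_moebius A analytic_on {z}"
    using \<open>open \<H>\<close> z analytic_at by blast
  have deriv: "deriv (\<lambda>x. mat_moebius A x - t) z \<noteq> 0"
    using DERIV_imp_deriv[OF has_field_derivative_mat_moebius[OF det z]] aut_factor_nonzero[OF det z]
    by (simp add: deriv_diff_const)
  have simple: "zorder (\<lambda>x. mat_moebius A x - t) z = 1"
    by (rule zorder_zero_eqI[of _ \<H>])
       (use hol \<open>open \<H>\<close> z deriv in \<open>auto intro!: holomorphic_intros simp: t_def\<close>)
  have "f meromorphic_on {t}" unfolding f_def by (rule t.meromorphic_diff)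
  moreover have "eventually (\<lambda>x. f x \<noteq> 0) (at t)"
    unfolding f_def by (rule t.eventually_diff_nonzero)
  moreover have "eventually (\<lambda>x. mat_moebius A x \<noteq> t) (at z)"
    using filterlim_mat_moebius[OF det z] by (simp add: filterlim_at t_def)
  ultimately have "zorder (f \<circ> mat_moebius A) z = zorder f t"
    using zorder_compose'[of f "mat_moebius A" z] an simple
    by (simp add: meromorphic_at_iff flip: t_def)
  moreover have "eventually (\<lambda>x. (f \<circ> mat_moebius A) x = f x) (at z)"
    using eventually_at_H[OF z]
    by eventually_elim (simp add: f_def hauptmodul_mat_moebius[OF \<Gamma> w A])
  then have "zorder (f \<circ> mat_moebius A) z = zorder f z"
    by (rule zorder_cong) simp
  ultimately show ?thesis using r by (simp add: t_def)
qed

lemma card_stabilizer_le_ramification: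
  assumes \<Gamma>: "subgroup \<Gamma> PSL2R" and w: "hauptmodul \<Gamma> w" and z: "z \<in> \<H>"
  shows "0 < card (stabilizer \<Gamma> (Some z))"
    and "card (stabilizer \<Gamma> (Some z)) \<le> ramification w z"
proof -
  interpret nonconstant_at w z using hauptmodul_nonconstant_at[OF assms] .
  define c where "c = (if is_pole w z then 0 else w z)"
  define f where "f = (\<lambda>x. w x - c)"
  have r: "ramification w z = nat \<bar>zorder f z\<bar>"
    by (auto simp: ramification_def f_def c_def)
  have f: "f meromorphic_on {z}" "eventually (\<lambda>x. f x \<noteq> 0) (at z)"
    unfolding f_def by (rule meromorphic_diff eventually_diff_nonzero)+
  have "zorder f z \<noteq> 0" using ramification_pos r by auto
  moreover have "eventually (\<lambda>x. f (mat_moebius A x) = f x) (at z)" if "psl_class A \<in> \<Gamma>" for A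
    using eventually_at_H[OF z]
    by eventually_elim (simp add: f_def hauptmodul_mat_moebius[OF \<Gamma> w that])
  ultimately show "0 < card (stabilizer \<Gamma> (Some z))"
    "card (stabilizer \<Gamma> (Some z)) \<le> ramification w z"
    unfolding r using card_stabilizer_le_zorder[OF \<Gamma> z f] by blast+
qed


section \<open>Vertices over a given value\<close>

text \<open>
  A vertex with the same value as \<open>z\<close> lies in the orbit of \<open>z\<close>. In particular it is an interior
  point and not a cusp, so its order is finite and bounded by the ramification.
\<close>

lemma vertex_over_interior_value:
  assumes \<Gamma>: "subgroup \<Gamma> PSL2R" and w: "hauptmodul \<Gamma> w" and z: "z \<in> \<H>"
    and p: "p \<in> elliptic_points \<Gamma> \<union> cusps \<Gamma>" "extended_value \<Gamma> w p = sphere_value w z"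
  shows "orbit \<Gamma> p = orbit \<Gamma> (Some z)"
    and "\<exists>N. vertex_order \<Gamma> p = enat N \<and> 0 < N \<and> N \<le> ramification w z"
proof -
  have "p \<in> Hstar \<Gamma>" using p(1) by (auto simp: elliptic_points_def Hstar_def)
  moreover have "Some z \<in> Hstar \<Gamma>" using z by (simp add: Hstar_def)
  ultimately show orb: "orbit \<Gamma> p = orbit \<Gamma> (Some z)"
    using p(2) extended_value_H[OF z] by (intro hauptmodul_separates_orbits[OF w]) auto
  then have "p \<in> orbit \<Gamma> (Some z)" using mem_orbit[OF \<Gamma>, of p] by simp
  then obtain A where A: "psl_class A \<in> \<Gamma>" "det A = 1" "p = Some (mat_moebius A z)"
    using orbit_H_cases[OF \<Gamma> z] by blast
  have t: "mat_moebius A z \<in> \<H>" using mat_moebius_in_H[OF A(2) z] .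
  then have "p \<notin> cusps \<Gamma>" by (auto simp: A(3) cusps_def)
  then have "vertex_order \<Gamma> p = enat (card (stabilizer \<Gamma> (Some (mat_moebius A z))))"
    by (simp add: vertex_order_def A(3))
  then show "\<exists>N. vertex_order \<Gamma> p = enat N \<and> 0 < N \<and> N \<le> ramification w z"
    using card_stabilizer_le_ramification[OF \<Gamma> w t] ramification_mat_moebius[OF \<Gamma> w A(1) z] by auto
qed

lemma floor_vertex_exponent_bound:
  assumes "0 < N" "N \<le> m"
  shows "int m * \<lfloor>real K * (1 - recip_order (enat N))\<rfloor> \<le> int K * (int m - 1)"
proof -
  have "1 / real m \<le> 1 / real N" using assms by (simp add: frac_le)
  then have "real K * (1 - recip_order (enat N)) \<le> real K * (1 - 1 / real m)"
    by (intro mult_left_mono) (auto simp: recip_order_def)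
  then have "real_of_int \<lfloor>real K * (1 - recip_order (enat N))\<rfloor> \<le> real K * (1 - 1 / real m)"
    by linarith
  then have "real m * real_of_int \<lfloor>real K * (1 - recip_order (enat N))\<rfloor>
      \<le> real m * (real K * (1 - 1 / real m))"
    by (intro mult_left_mono) auto
  also have "\<dots> = real K * (real m - 1)" using assms by (simp add: field_simps)
  finally have "real_of_int (int m * \<lfloor>real K * (1 - recip_order (enat N))\<rfloor>)
      \<le> real_of_int (int K * (int m - 1))" by simp
  then show ?thesis by (simp only: of_int_le_iff)
qed

text \<open>
  The vertices are inequivalent, so the sum has at most one term. An empty sum is covered by
  \<open>m \<ge> 1\<close>; this is the case of all points \<open>z\<close> that are not elliptic.
\<close>

lemma sum_vertex_exponents_bound:
  assumes \<Gamma>: "subgroup \<Gamma> PSL2R" and w: "hauptmodul \<Gamma> w" and sig: "has_signature \<Gamma> g r \<tau> n"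
    and a: "\<And>i. i \<in> {1..r} \<Longrightarrow> a i = \<lfloor>real K * (1 - recip_order (n i))\<rfloor>" and z: "z \<in> \<H>"
  shows "int (ramification w z) *
           (\<Sum>i | i \<in> {1..r} \<and> extended_value \<Gamma> w (\<tau> i) = sphere_value w z. a i)
         \<le> int K * (int (ramification w z) - 1)"
proof -
  define B where "B = {i. i \<in> {1..r} \<and> extended_value \<Gamma> w (\<tau> i) = sphere_value w z}"
  interpret nonconstant_at w z using hauptmodul_nonconstant_at[OF \<Gamma> w z] .
  have vert: "\<tau> i \<in> elliptic_points \<Gamma> \<union> cusps \<Gamma>" "n i = vertex_order \<Gamma> (\<tau> i)" if "i \<in> {1..r}" for i
    using sig that unfolding has_signature_def by blast+
  have inj: "inj_on (\<lambda>i. orbit \<Gamma> (\<tau> i)) {1..r}"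
    using sig unfolding has_signature_def by blast
  have "int (ramification w z) * sum a B \<le> int K * (int (ramification w z) - 1)"
  proof (cases "B = {}")
    case True
    then show ?thesis using ramification_pos by simp
  next
    case False
    then obtain i where i: "i \<in> B" by blast
    have over: "orbit \<Gamma> (\<tau> l) = orbit \<Gamma> (Some z)" if "l \<in> B" for l
      using that vert by (intro vertex_over_interior_value(1)[OF \<Gamma> w z]) (auto simp: B_def)
    have "B = {i}"
    proof (intro subset_antisym subsetI)
      fix l assume "l \<in> B"
      then have "l = i" using over i by (intro inj_onD[OF inj]) (auto simp: B_def)
      then show "l \<in> {i}" by simp
    qed (use i in auto)
    moreover obtain N where "n i = enat N" "0 < N" "N \<le> ramification w z"
      using vertex_over_interior_value(2)[OF \<Gamma> w z, of "\<tau> i"] vert[of i] i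
      by (auto simp: B_def)
    moreover have "a i = \<lfloor>real K * (1 - recip_order (n i))\<rfloor>"
      using i by (intro a) (auto simp: B_def)
    ultimately show ?thesis
      using floor_vertex_exponent_bound[of N "ramification w z" K] by simp
  qed
  then show ?thesis by (simp only: B_def)
qed


section \<open>The transformation law\<close>

lemma deriv_hauptmodul_mat_moebius:
  assumes \<Gamma>: "subgroup \<Gamma> PSL2R" and w: "hauptmodul \<Gamma> w" and A: "psl_class A \<in> \<Gamma>" and z: "z \<in> \<H>"
    and pole: "\<not> is_pole w z"
  shows "deriv w (mat_moebius A z) = (aut_factor A z)\<^sup>2 * deriv w z"
proof -
  have det: "det A = 1" using psl_class_in_subgroupD[OF \<Gamma> A] .
  define t where "t = mat_moebius A z"
  have t: "t \<in> \<H>" using mat_moebius_in_H[OF det z] by (simp add: t_def)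
  have "\<not> is_pole w t"
    using hauptmodul_is_pole_mat_moebius[OF w A z] pole by (simp add: t_def)
  then have "w analytic_on {t}"
    using nonconstant_at.analytic[OF hauptmodul_nonconstant_at[OF \<Gamma> w t]] by simp
  then have "(w has_field_derivative deriv w t) (at t)"
    using analytic_on_imp_differentiable_at DERIV_deriv_iff_field_differentiable by blast
  then have comp: "((\<lambda>x. w (mat_moebius A x)) has_field_derivative
      deriv w t * (1 / (aut_factor A z)\<^sup>2)) (at z)"
    unfolding t_def by (rule DERIV_chain2) (rule has_field_derivative_mat_moebius[OF det z])
  have ev: "eventually (\<lambda>x. w (mat_moebius A x) = w x) (nhds z)"
  proof -
    have "eventually (\<lambda>x. x \<in> \<H>) (nhds z)"
      using z by (intro eventually_nhds_in_open) (auto simp: open_halfspace_Im_gt)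
    then show ?thesis
      by eventually_elim (rule hauptmodul_mat_moebius[OF \<Gamma> w A])
  qed
  have "(w has_field_derivative deriv w t * (1 / (aut_factor A z)\<^sup>2)) (at z)"
    using comp DERIV_cong_ev[OF refl ev refl] by (rule iffD1[rotated])
  then have "deriv w z = deriv w t * (1 / (aut_factor A z)\<^sup>2)"
    by (rule DERIV_imp_deriv)
  then show ?thesis
    using aut_factor_nonzero[OF det z] by (simp add: t_def)
qed

lemma derivative_quotient_mat_moebius:
  assumes \<Gamma>: "subgroup \<Gamma> PSL2R" and w: "hauptmodul \<Gamma> w" and A: "psl_class A \<in> \<Gamma>" and z: "z \<in> \<H>"
    and pole: "\<not> is_pole w z"
  shows "derivative_quotient w K j I v a (mat_moebius A z)
      = aut_factor A z ^ (2 * K) * derivative_quotient w K j I v a z"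
  unfolding derivative_quotient_def hauptmodul_mat_moebius[OF \<Gamma> w A z]
    deriv_hauptmodul_mat_moebius[OF assms]
  by (simp add: power_mult_distrib power_mult)

text \<open>
  The transformation law is known for the quotient off the poles of \<open>w\<close>, hence for its extension
  \<open>h\<close> in a punctured neighbourhood of every point. Both sides are continuous, so it holds at the
  point itself.
\<close>

lemma automorphic_form_remove_sings_derivative_quotient:
  assumes \<Gamma>: "subgroup \<Gamma> PSL2R" and w: "hauptmodul \<Gamma> w" and fin: "finite I"
    and ord: "\<And>z. z \<in> \<H> \<Longrightarrow> zorder (derivative_quotient w K j I v a) z \<ge> 0"
  shows "automorphic_form \<Gamma> (2 * K) (remove_sings (derivative_quotient w K j I v a))"
proof -
  define q where "q = derivative_quotient w K j I v a"
  define h where "h = remove_sings q"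
  have analytic: "h analytic_on {z}" if "z \<in> \<H>" for z
    unfolding h_def q_def
    using nonconstant_at.remove_sings_derivative_quotient_analytic
      [OF hauptmodul_nonconstant_at[OF \<Gamma> w that] fin ord[OF that]] .
  have h_tendsto: "h \<midarrow>z\<rightarrow> h z" if "z \<in> \<H>" for z
    using analytic_at_imp_isCont[OF analytic[OF that]] by (simp add: isCont_def)
  have h_eq: "eventually (\<lambda>x. h x = q x) (at z)" if "z \<in> \<H>" for z
  proof -
    have "q meromorphic_on {z}"
      unfolding q_def by (rule nonconstant_at.derivative_quotient_meromorphic
        [OF hauptmodul_nonconstant_at[OF \<Gamma> w that] fin])
    then show ?thesis
      unfolding h_def by (intro eventually_remove_sings_eq_at) (simp add: meromorphic_at_iff)
  qed
  have "h holomorphic_on \<H>"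
    using analytic analytic_imp_holomorphic analytic_on_analytic_at by blast
  moreover have "h (mat_moebius A z) = aut_factor A z ^ (2 * K) * h z"
    if A: "psl_class A \<in> \<Gamma>" and z: "z \<in> \<H>" for A z
  proof -
    have det: "det A = 1" using psl_class_in_subgroupD[OF \<Gamma> A] .
    have t: "mat_moebius A z \<in> \<H>" using mat_moebius_in_H[OF det z] .
    have flim: "filterlim (mat_moebius A) (at (mat_moebius A z)) (at z)"
      by (rule filterlim_mat_moebius[OF det z])
    have "w meromorphic_on {z}"
      using nonconstant_at.meromorphic[OF hauptmodul_nonconstant_at[OF \<Gamma> w z]] .
    then have "eventually (\<lambda>x. \<not> is_pole w x) (at z)"
      by (intro eventually_not_pole) (simp add: meromorphic_at_iff)
    moreover have "eventually (\<lambda>x. h (mat_moebius A x) = q (mat_moebius A x)) (at z)"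
      using h_eq[OF t] flim by (rule eventually_compose_filterlim)
    ultimately have "eventually (\<lambda>x. h (mat_moebius A x) = aut_factor A x ^ (2 * K) * h x) (at z)"
      using h_eq[OF z] eventually_at_H[OF z]
    proof eventually_elim
      case (elim x)
      then show ?case
        using derivative_quotient_mat_moebius[OF \<Gamma> w A, of x K j I v a] by (simp add: q_def)
    qed
    moreover have "((\<lambda>x. h (mat_moebius A x)) \<longlongrightarrow> h (mat_moebius A z)) (at z)"
      by (rule filterlim_compose[OF h_tendsto[OF t] flim])
    ultimately have "((\<lambda>x. aut_factor A x ^ (2 * K) * h x) \<longlongrightarrow> h (mat_moebius A z)) (at z)"
      using Lim_transform_eventually by fast
    moreover have "((\<lambda>x. aut_factor A x ^ (2 * K) * h x) \<longlongrightarrow> aut_factor A z ^ (2 * K) * h z) (at z)"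
      unfolding aut_factor_def by (intro tendsto_intros h_tendsto z)
    ultimately show ?thesis
      by (intro tendsto_unique[of "at z"]) auto
  qed
  ultimately show ?thesis
    unfolding automorphic_form_def h_def q_def by blast
qed

theorem lemma1:
  fixes \<Gamma> :: "(real^2^2) set set" and r k j :: nat
    and \<tau> :: "nat \<Rightarrow> complex option" and n :: "nat \<Rightarrow> enat"
    and w :: "complex \<Rightarrow> complex" and a :: "nat \<Rightarrow> int" and d :: int
  assumes "fuchsian \<Gamma>"
    and "compact_space (Xhat_topology \<Gamma>)"
    and "has_signature \<Gamma> 0 r \<tau> n"
    and "hauptmodul \<Gamma> w"
    and "k \<ge> 4" and "even k"
    and "\<And>i. i \<in> {1..r} \<Longrightarrow> a i = \<lfloor>real k / 2 * (1 - recip_order (n i))\<rfloor>"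
    and "d = 1 - int k + (\<Sum>i=1..r. a i)"
    and "int j \<le> d - 1"
  shows "automorphic_form \<Gamma> k
    (remove_sings (\<lambda>z. deriv w z ^ (k div 2) * w z ^ j /
       (\<Prod>i \<in> {i \<in> {1..r}. extended_value \<Gamma> w (\<tau> i) \<noteq> None}.
          (w z - the (extended_value \<Gamma> w (\<tau> i))) powi a i)))"
proof -
  define K where "K = k div 2"
  have k: "k = 2 * K" using \<open>even k\<close> by (simp add: K_def)
  have \<Gamma>: "subgroup \<Gamma> PSL2R" using \<open>fuchsian \<Gamma>\<close> by (simp add: fuchsian_def)
  have "zorder (derivative_quotient w K j {1..r} (\<lambda>i. extended_value \<Gamma> w (\<tau> i)) a) z \<ge> 0"
    if z: "z \<in> \<H>" for z
  proof (rule nonconstant_at.zorder_derivative_quotient_nonneg)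
    show "nonconstant_at w z" by (rule hauptmodul_nonconstant_at[OF \<Gamma> \<open>hauptmodul \<Gamma> w\<close> z])
    show "int (ramification w z) *
        (\<Sum>i | i \<in> {1..r} \<and> extended_value \<Gamma> w (\<tau> i) = sphere_value w z. a i)
        \<le> int K * (int (ramification w z) - 1)"
      using assms(7) k
      by (intro sum_vertex_exponents_bound[OF \<Gamma> \<open>hauptmodul \<Gamma> w\<close> assms(3) _ z]) simp
    show "2 * int K + int j \<le> (\<Sum>i\<in>{1..r}. a i)"
      using assms(8,9) k by simp
  qed simp
  then have "automorphic_form \<Gamma> (2 * K)
      (remove_sings (derivative_quotient w K j {1..r} (\<lambda>i. extended_value \<Gamma> w (\<tau> i)) a))"
    by (intro automorphic_form_remove_sings_derivative_quotient[OF \<Gamma> \<open>hauptmodul \<Gamma> w\<close>]) auto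
  then show ?thesis
    by (simp add: derivative_quotient_def[abs_def] k)
qed

end
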